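(* Let $n=6$ and let $\boldsymbol v^0(\cdot,\boldsymbol\xi)$ be the sextuple-periodic field of the context, with convective field $\boldsymbol g^0$. For $\boldsymbol\xi=(-\tfrac{\pi}{4},\tfrac{\pi}{4},\tfrac{\pi}{4},\tfrac{\pi}{4},\tfrac{\pi}{4},\tfrac{\pi}{4})$ the field $\boldsymbol g^0$ is not curl-free: there exist $i,j$ for which $\partial g_i^0/\partial x_j\neq\partial g_j^0/\partial x_i$ (as functions). Consequently no single-valued pressure satisfies $\partial p/\partial x_i=-\rho\,g_i^0(\boldsymbol x)\,e^{-12\alpha^2\kappa t}$ for all $i$, and this phase vector does not yield a solution $\boldsymbol v=\boldsymbol v^0e^{-6\alpha^2\kappa t}$ of the unforced incompressible Navier--Stokes equations. Moreover, no phase assignment $\boldsymbol\xi\in\{-\tfrac{\pi}{4},+\tfrac{\pi}{4}\}^6$ renders $\boldsymbol g^0$ curl-free without forcing $\boldsymbol v^0\equiv\boldsymbol 0$; and a complementary numerical search over continuous $\boldsymbol\xi\in\mathbb R^6$ found no nontrivial curl-free phase vector, i.e. no $\boldsymbol\xi$ for which $\boldsymbol g^0$ is curl-free and $\boldsymbol v^0\not\equiv\boldsymbol 0$.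
   Context: Fix $\alpha>0$, $v_r>0$, density $\rho>0$, viscosity $\kappa>0$. For a phase vector $\boldsymbol\xi=(\xi_1,\dots,\xi_6)\in\mathbb R^6$ the first component of the field is $$\frac{v_1^0}{v_r}=\sin(\alpha x_1+\xi_1)\cos(\alpha x_2+\xi_2)\sin(\alpha x_3+\xi_3)\cos(\alpha x_4+\xi_4)\sin(\alpha x_5+\xi_5)\cos(\alpha x_6+\xi_6)$$ $$-\sin(\alpha x_1+\xi_2)\sin(\alpha x_2+\xi_3)\cos(\alpha x_3+\xi_4)\sin(\alpha x_4+\xi_5)\cos(\alpha x_5+\xi_6)\cos(\alpha x_6+\xi_1),$$ and $v_i^0$ is obtained from $v_1^0$ by the cyclic coordinate permutation $x_j\mapsto x_{i+j-1}$ (indices modulo 6, in $\{1,\dots,6\}$) with the same $\boldsymbol\xi$. The convective field is $g_i^0=\sum_{j=1}^6v_j^0\,\partial v_i^0/\partial x_j$, and $\boldsymbol g^0$ is called curl-free if $\partial g_i^0/\partial x_j=\partial g_j^0/\partial x_i$ identically for all $i,j$. The unforced incompressible Navier--Stokes equations are $\partial_tv_i+\sum_jv_j\partial_jv_i=\kappa\Delta v_i-\rho^{-1}\partial_ip$ for all $i$, together with $\nabla\cdot\boldsymbol v=0$. The final clause of the claim reports the outcome of a numerical search, offered as supporting evidence and not as a proved non-existence statement over $\mathbb R^6$. *)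

theory Defs
  imports "HOL-Analysis.Analysis"
begin

(* Coordinates are indexed by the type 6, i.e. by the residues modulo 6: the numerals 1, ..., 6
   name its six distinct elements (with 6 = 0), and index arithmetic is arithmetic modulo 6. *)

definition has_partial_deriv ::
    "(real ^ 'n \<Rightarrow> real) \<Rightarrow> 'n::finite \<Rightarrow> real \<Rightarrow> real ^ 'n \<Rightarrow> bool" where
  "has_partial_deriv f j D x \<longleftrightarrow>
     ((\<lambda>s. f (x + s *\<^sub>R axis j 1)) has_real_derivative D) (at 0)"

definition partial_differentiable ::
    "(real ^ 'n \<Rightarrow> real) \<Rightarrow> 'n::finite \<Rightarrow> real ^ 'n \<Rightarrow> bool" where
  "partial_differentiable f j x \<longleftrightarrow> (\<exists>D. has_partial_deriv f j D x)"

definition partial_deriv :: "'n::finite \<Rightarrow> (real ^ 'n \<Rightarrow> real) \<Rightarrow> real ^ 'n \<Rightarrow> real" where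
  "partial_deriv j f x = deriv (\<lambda>s. f (x + s *\<^sub>R axis j 1)) 0"

definition convective_field :: "(real ^ 'n \<Rightarrow> real ^ 'n) \<Rightarrow> real ^ 'n \<Rightarrow> real ^ 'n::finite" where
  "convective_field v x = (\<chi> i. \<Sum>j\<in>UNIV. v x $ j * partial_deriv j (\<lambda>y. v y $ i) x)"

definition curl_free :: "(real ^ 'n \<Rightarrow> real ^ 'n::finite) \<Rightarrow> bool" where
  "curl_free g \<longleftrightarrow>
     (\<forall>i j x. partial_deriv j (\<lambda>y. g y $ i) x = partial_deriv i (\<lambda>y. g y $ j) x)"

(* Classical solutions on a set T of times, with density rho and kinematic viscosity kappa. Only
   the partial derivatives that occur in the equations are required to exist. *)
definition navier_stokes_solution ::
    "real \<Rightarrow> real \<Rightarrow> real set \<Rightarrow> (real \<Rightarrow> real ^ 'n \<Rightarrow> real ^ 'n) \<Rightarrow>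
     (real \<Rightarrow> real ^ 'n::finite \<Rightarrow> real) \<Rightarrow> bool" where
  "navier_stokes_solution \<rho> \<kappa> T v p \<longleftrightarrow>
     (\<forall>t\<in>T. \<forall>x.
        (\<forall>i. (\<lambda>s. v s x $ i) differentiable (at t) \<and>
             partial_differentiable (p t) i x \<and>
             (\<forall>j. partial_differentiable (\<lambda>y. v t y $ i) j x \<and>
                  partial_differentiable (partial_deriv j (\<lambda>y. v t y $ i)) j x)) \<and>
        (\<forall>i. deriv (\<lambda>s. v s x $ i) t
               + (\<Sum>j\<in>UNIV. v t x $ j * partial_deriv j (\<lambda>y. v t y $ i) x)
             = \<kappa> * (\<Sum>j\<in>UNIV. partial_deriv j (partial_deriv j (\<lambda>y. v t y $ i)) x)
               - inverse \<rho> * partial_deriv i (p t) x) \<and>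
        (\<Sum>i\<in>UNIV. partial_deriv i (\<lambda>y. v t y $ i) x) = 0)"

definition v0_first :: "real \<Rightarrow> real \<Rightarrow> real ^ 6 \<Rightarrow> real ^ 6 \<Rightarrow> real" where
  "v0_first \<alpha> v\<^sub>r \<xi> x = v\<^sub>r *
     (sin (\<alpha> * x $ 1 + \<xi> $ 1) * cos (\<alpha> * x $ 2 + \<xi> $ 2) * sin (\<alpha> * x $ 3 + \<xi> $ 3)
        * cos (\<alpha> * x $ 4 + \<xi> $ 4) * sin (\<alpha> * x $ 5 + \<xi> $ 5) * cos (\<alpha> * x $ 6 + \<xi> $ 6)
      - sin (\<alpha> * x $ 1 + \<xi> $ 2) * sin (\<alpha> * x $ 2 + \<xi> $ 3) * cos (\<alpha> * x $ 3 + \<xi> $ 4)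
        * sin (\<alpha> * x $ 4 + \<xi> $ 5) * cos (\<alpha> * x $ 5 + \<xi> $ 6) * cos (\<alpha> * x $ 6 + \<xi> $ 1))"

definition v0 :: "real \<Rightarrow> real \<Rightarrow> real ^ 6 \<Rightarrow> real ^ 6 \<Rightarrow> real ^ 6" where
  "v0 \<alpha> v\<^sub>r \<xi> x = (\<chi> i. v0_first \<alpha> v\<^sub>r \<xi> (\<chi> j. x $ (i + j - 1)))"

definition g0 :: "real \<Rightarrow> real \<Rightarrow> real ^ 6 \<Rightarrow> real ^ 6 \<Rightarrow> real ^ 6" where
  "g0 \<alpha> v\<^sub>r \<xi> = convective_field (v0 \<alpha> v\<^sub>r \<xi>)"

definition \<xi>0 :: "real ^ 6" where
  "\<xi>0 = (\<chi> i. if i = 1 then - (pi / 4) else pi / 4)"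

end

theory Submission
  imports Defs
begin

text \<open>
  Up to the factor \<open>v\<^sub>r\<close>, every velocity component is a difference of two products of six sines, one
  sine per coordinate, because a cosine is a sine a quarter turn ahead. Differentiating in
  \<open>x\<^sub>j\<close> multiplies such a product by \<open>\<alpha>\<close> and advances its \<open>j\<close>-th factor by a quarter turn
  (lemma \<open>velocity_jet_has_partial_deriv\<close>), so all derivatives of the velocity, and with them the
  Jacobian of the convective field, are explicit sums of products of sines
  (\<open>g0_has_partial_deriv\<close>). Deciding whether the convective field is curl-free thus becomes a
  question about finitely many sines at well-chosen points.

  Take phases \<open>\<xi> $ m = s m * pi / 4\<close> with signs \<open>s m\<close>. At the origin, and at the origin moved by a
  quarter period in some coordinates, every sine occurring is \<open>\<plusminus>1 / sqrt 2\<close>, and an entry of the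
  curl is, up to a common nonzero factor, an integer polynomial in the signs. Moving only the sixth
  coordinate by a quarter period, the entries (1,2) and (1,6) of the curl vanish together for just
  four of the 64 sign vectors (\<open>signs_if_lattice_curl_vanishes\<close>). Two of them, \<open>\<plusminus>(1, 1, -1, 1, -1, 1)\<close>, make the two
  sine products equal, so that the velocity is zero (\<open>v0_zero_if_degenerate\<close>). The other two
  are \<open>\<plusminus>(-1, 1, 1, 1, 1, 1)\<close>, that is, the phase vector of the theorem and its negative; for these
  another point, where the sines of the coordinates 2, 3 and 4 are 0 or \<open>\<plusminus>1\<close>, gives a
  nonzero entry (1,6) of the curl (\<open>exceptional_curl\<close>).

  The statements about the pressure follow from the symmetry of second derivatives. A gradient
  with continuously differentiable components has a symmetric Jacobian
  (\<open>jacobian_of_gradient_symmetric\<close>), so a pressure can only exist if the convective field is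
  curl-free. The velocity is an eigenfunction of the Laplacian with eigenvalue \<open>- 6 * \<alpha>\<^sup>2\<close>, whence
  the viscous term cancels the time derivative of \<open>exp (- 6 * \<alpha>\<^sup>2 * \<kappa> * t) *\<^sub>R v0\<close> and the
  Navier-Stokes equations force the pressure gradient to be the one in question
  (\<open>navier_stokes_pressure_gradient\<close>).
\<close>

section \<open>Coordinates modulo six\<close>

lemma exhaust_6:
  fixes x :: 6
  shows "x = 1 \<or> x = 2 \<or> x = 3 \<or> x = 4 \<or> x = 5 \<or> x = 6"
proof (induct x)
  case (of_int z)
  then have "z = 0 \<or> z = 1 \<or> z = 2 \<or> z = 3 \<or> z = 4 \<or> z = 5" by fastforce
  then show ?case by auto
qed

lemma UNIV_6: "UNIV = {1, 2, 3, 4, 5, 6::6}"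
  using exhaust_6 by auto

lemma sum_6: "sum f (UNIV::6 set) = f 1 + f 2 + f 3 + f 4 + f 5 + f 6"
  unfolding UNIV_6 by (simp add: ac_simps)

lemma prod_6: "prod f (UNIV::6 set) = f 1 * f 2 * f 3 * f 4 * f 5 * f 6"
  unfolding UNIV_6 by (simp add: ac_simps)

text \<open>
  Shifting a numeral index cyclically produces numerals outside \<open>1, ..., 6\<close>; these rules bring them
  back to the representatives by which the coordinates are named.
\<close>
lemma index_mod_6:
  "(0::6) = 6" "(7::6) = 1" "(8::6) = 2" "(9::6) = 3" "(10::6) = 4" "(11::6) = 5" "(12::6) = 6"
  "(13::6) = 1" "(14::6) = 2" "(15::6) = 3" "(16::6) = 4"
  "(-1::6) = 5" "(-2::6) = 4" "(-3::6) = 3" "(-4::6) = 2" "(-5::6) = 1"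
  by simp_all

section \<open>Partial derivatives and gradients\<close>

lemma partial_deriv_eqI: "has_partial_deriv f j D x \<Longrightarrow> partial_deriv j f x = D"
  unfolding has_partial_deriv_def partial_deriv_def by (rule DERIV_imp_deriv)

lemma has_partial_deriv_partial_deriv:
  "partial_differentiable f j x \<Longrightarrow> has_partial_deriv f j (partial_deriv j f x) x"
  unfolding partial_differentiable_def using partial_deriv_eqI by blast

lemma has_partial_deriv_along_line:
  assumes "\<And>y. has_partial_deriv f j (D y) y"
  shows "((\<lambda>s. f (x + s *\<^sub>R axis j 1)) has_real_derivative D (x + t *\<^sub>R axis j 1)) (at t)"
proof -
  have "((\<lambda>s. f (x + t *\<^sub>R axis j 1 + s *\<^sub>R axis j 1)) has_real_derivative
      D (x + t *\<^sub>R axis j 1)) (at 0)"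
    using assms unfolding has_partial_deriv_def by blast
  then have "((\<lambda>s. f (x + (t + s) *\<^sub>R axis j 1)) has_real_derivative
      D (x + t *\<^sub>R axis j 1)) (at 0)"
    by (simp add: algebra_simps)
  then show ?thesis
    using DERIV_at_within_shift[of "\<lambda>s. f (x + s *\<^sub>R axis j 1)" "D (x + t *\<^sub>R axis j 1)" t 0 UNIV]
    by (simp add: add.commute)
qed

lemma has_partial_deriv_cmult:
  "has_partial_deriv f j D x \<Longrightarrow> has_partial_deriv (\<lambda>y. c * f y) j (c * D) x"
  unfolding has_partial_deriv_def by (rule DERIV_cmult)

text \<open>
  The difference of \<open>p\<close> along the \<open>j\<close>-th axis is the integral of \<open>G j\<close>; differentiating
  it along the \<open>i\<close>-th axis, once directly and once under the integral sign, expresses a difference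
  of \<open>G i\<close> as the integral of \<open>H j i\<close>, and its derivative along the \<open>j\<close>-th axis is both \<open>H i j\<close> and
  \<open>H j i\<close>.
\<close>
lemma jacobian_of_gradient_symmetric:
  fixes p :: "real ^ 'n::finite \<Rightarrow> real"
  assumes p: "\<And>i x. has_partial_deriv p i (G i x) x"
    and G: "\<And>i j x. has_partial_deriv (G i) j (H i j x) x"
    and H: "\<And>i j. continuous_on UNIV (H i j)"
  shows "H i j x = H j i x"
proof -
  define L where "L s t = x + s *\<^sub>R axis i 1 + t *\<^sub>R axis j 1" for s t :: real
  have L_swap: "L s t = (x + t *\<^sub>R axis j 1) + s *\<^sub>R axis i 1" for s t
    by (simp add: L_def algebra_simps)
  have cont_H: "continuous_on A (\<lambda>z. H a b (L (f z) (g z)))"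
    if "continuous_on A f" "continuous_on A g" for a b and A :: "'c::topological_space set" and f g
    unfolding L_def
    by (rule continuous_on_compose2[OF H]) (auto intro!: continuous_intros that)
  have int_G: "((\<lambda>\<tau>. G j (L s \<tau>)) has_integral p (L s t) - p (L s 0)) {0..t}"
    if "0 \<le> t" for s t
  proof (rule fundamental_theorem_of_calculus[OF that])
    fix \<tau> assume "\<tau> \<in> {0..t}"
    show "((\<lambda>\<tau>. p (L s \<tau>)) has_vector_derivative G j (L s \<tau>)) (at \<tau> within {0..t})"
      unfolding L_def has_real_derivative_iff_has_vector_derivative[symmetric]
      by (rule has_field_derivative_at_within, rule has_partial_deriv_along_line, rule p)
  qed
  have int_H: "G i (L 0 t) - G i (L 0 0) = integral {0..t} (\<lambda>\<tau>. H j i (L 0 \<tau>))"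
    if "0 \<le> t" for t
  proof -
    have "((\<lambda>s. integral (cbox 0 t) (\<lambda>\<tau>. G j (L s \<tau>))) has_field_derivative
        integral (cbox 0 t) (\<lambda>\<tau>. H j i (L 0 \<tau>))) (at 0 within UNIV)"
    proof (rule leibniz_rule_field_derivative[where U = UNIV])
      show "((\<lambda>s. G j (L s \<tau>)) has_field_derivative H j i (L s \<tau>)) (at s within UNIV)" for s \<tau>
        unfolding L_swap by (rule has_partial_deriv_along_line, rule G)
      show "(\<lambda>\<tau>. G j (L s \<tau>)) integrable_on cbox 0 t" for s
        using int_G[OF that] by (auto simp: integrable_on_def)
      show "continuous_on (UNIV \<times> cbox 0 t) (\<lambda>(s, \<tau>). H j i (L s \<tau>))"
        by (auto simp: split_beta intro!: cont_H continuous_intros)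
    qed auto
    moreover have "integral (cbox 0 t) (\<lambda>\<tau>. G j (L s \<tau>)) = p (L s t) - p (L s 0)" for s
      using int_G[OF that] by (simp add: integral_unique)
    ultimately have "((\<lambda>s. p (L s t) - p (L s 0)) has_real_derivative
        integral {0..t} (\<lambda>\<tau>. H j i (L 0 \<tau>))) (at 0)"
      by simp
    moreover have "((\<lambda>s. p (L s t) - p (L s 0)) has_real_derivative
        G i (L 0 t) - G i (L 0 0)) (at 0)"
      unfolding L_swap by (intro DERIV_diff has_partial_deriv_along_line p)
    ultimately show ?thesis
      by (rule DERIV_unique[symmetric])
  qed
  have "((\<lambda>t. integral {0..t} (\<lambda>\<tau>. H j i (L 0 \<tau>))) has_vector_derivative H j i (L 0 0))
      (at 0 within {0..1})"
    by (rule integral_has_vector_derivative) (auto intro!: cont_H continuous_intros)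
  then have "((\<lambda>t. G i (L 0 t) - G i (L 0 0)) has_vector_derivative H j i (L 0 0))
      (at 0 within {0..1})"
    by (rule has_vector_derivative_transform[rotated 2]) (auto simp: int_H)
  moreover have "((\<lambda>t. G i (L 0 t) - G i (L 0 0)) has_vector_derivative H i j (L 0 0))
      (at 0 within {0..1})"
  proof -
    have "((\<lambda>t. G i (L 0 t)) has_real_derivative H i j (L 0 0)) (at 0)"
      unfolding L_def by (rule has_partial_deriv_along_line, rule G)
    then have "((\<lambda>t. G i (L 0 t) - G i (L 0 0)) has_real_derivative H i j (L 0 0) - 0) (at 0)"
      by (intro DERIV_diff DERIV_const)
    then show ?thesis
      unfolding has_real_derivative_iff_has_vector_derivative
      by (simp add: has_vector_derivative_at_within)
  qed
  ultimately have "H i j (L 0 0) = H j i (L 0 0)"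
    by (intro vector_derivative_unique_within[of 0 "{0..1}"])
       (auto simp: trivial_limit_within)
  then show ?thesis by (simp add: L_def)
qed

section \<open>Derivatives of the velocity\<close>

text \<open>
  The phases are split into a real part and a number of quarter turns, since the quarter turns are
  what differentiation changes.
\<close>
definition sinprod :: "real \<Rightarrow> real ^ 'n::finite \<Rightarrow> ('n \<Rightarrow> real) \<Rightarrow> ('n \<Rightarrow> nat) \<Rightarrow> real" where
  "sinprod \<alpha> x \<phi> q = (\<Prod>k\<in>UNIV. sin (\<alpha> * x $ k + \<phi> k + real (q k) * (pi / 2)))"

text \<open>
  A function \<open>'n \<Rightarrow> nat\<close> serves as the multi-index of a partial derivative as well as a count of
  quarter turns per factor; \<open>bump j\<close> raises the \<open>j\<close>-th entry of either.
\<close>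
definition bump :: "'n \<Rightarrow> ('n \<Rightarrow> nat) \<Rightarrow> 'n \<Rightarrow> nat" where
  "bump j D k = D k + (if k = j then 1 else 0)"

lemma sinprod_has_partial_deriv:
  "has_partial_deriv (\<lambda>y. sinprod \<alpha> y \<phi> q) j (\<alpha> * sinprod \<alpha> x \<phi> (bump j q)) x"
proof -
  define R where "R = (\<Prod>k\<in>UNIV-{j}. sin (\<alpha> * x $ k + \<phi> k + real (q k) * (pi / 2)))"
  have line: "sinprod \<alpha> (x + s *\<^sub>R axis j 1) \<phi> q
      = sin (\<alpha> * (x $ j + s) + \<phi> j + real (q j) * (pi / 2)) * R" for s
    unfolding sinprod_def R_def prod.remove[OF finite UNIV_I[of j]]
    by (intro arg_cong2[where f = "(*)"] prod.cong) (auto simp: axis_def)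
  have "sinprod \<alpha> x \<phi> (bump j q)
      = sin (\<alpha> * x $ j + \<phi> j + real (q j) * (pi / 2) + pi / 2) * R"
    unfolding sinprod_def R_def bump_def prod.remove[OF finite UNIV_I[of j]]
    by (intro arg_cong2[where f = "(*)"] prod.cong) (auto simp: algebra_simps add_divide_distrib)
  then have "sinprod \<alpha> x \<phi> (bump j q) = cos (\<alpha> * x $ j + \<phi> j + real (q j) * (pi / 2)) * R"
    by (simp add: sin_add)
  then show ?thesis
    unfolding has_partial_deriv_def line
    by (auto intro!: derivative_eq_intros)
qed

lemma continuous_on_sinprod: "continuous_on A (\<lambda>x. sinprod \<alpha> x \<phi> q)"
  unfolding sinprod_def by (intro continuous_intros)

lemma sinprod_bump_bump: "sinprod \<alpha> x \<phi> (bump j (bump j q)) = - sinprod \<alpha> x \<phi> q"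
proof -
  define R where "R = (\<Prod>k\<in>UNIV-{j}. sin (\<alpha> * x $ k + \<phi> k + real (q k) * (pi / 2)))"
  have *: "sinprod \<alpha> x \<phi> (bump j (bump j q))
      = sin (\<alpha> * x $ j + \<phi> j + real (q j) * (pi / 2) + pi) * R"
    unfolding sinprod_def R_def bump_def prod.remove[OF finite UNIV_I[of j]]
    by (intro arg_cong2[where f = "(*)"] prod.cong) (auto simp: algebra_simps)
  have "sinprod \<alpha> x \<phi> q = sin (\<alpha> * x $ j + \<phi> j + real (q j) * (pi / 2)) * R"
    unfolding sinprod_def R_def prod.remove[OF finite UNIV_I[of j]] ..
  with * show ?thesis by simp
qed

text \<open>
  The positions of the cosines in the first and in the second product of the velocity.
\<close>
definition quarters1 :: "6 \<Rightarrow> nat" where "quarters1 m = (if m \<in> {2, 4, 6} then 1 else 0)"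
definition quarters2 :: "6 \<Rightarrow> nat" where "quarters2 m = (if m \<in> {3, 5, 6} then 1 else 0)"

text \<open>
  The partial derivative of \<open>v0 $ i\<close> with multi-index \<open>D\<close>, without the factor \<open>v\<^sub>r\<close> and the powers
  of \<open>\<alpha>\<close>. The cyclic permutation of the coordinates is moved from the argument \<open>x\<close> to the
  phases: the coordinate \<open>k\<close> stands at position \<open>k - i + 1\<close> of the \<open>i\<close>-th component.
\<close>
definition velocity_jet :: "real \<Rightarrow> real ^ 6 \<Rightarrow> 6 \<Rightarrow> (6 \<Rightarrow> nat) \<Rightarrow> real ^ 6 \<Rightarrow> real" where
  "velocity_jet \<alpha> \<xi> i D x =
     sinprod \<alpha> x (\<lambda>k. \<xi> $ (k - i + 1)) (\<lambda>k. quarters1 (k - i + 1) + D k)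
   - sinprod \<alpha> x (\<lambda>k. \<xi> $ (k - i + 2)) (\<lambda>k. quarters2 (k - i + 1) + D k)"

lemma v0_nth: "v0 \<alpha> v\<^sub>r \<xi> x $ i = v\<^sub>r * velocity_jet \<alpha> \<xi> i (\<lambda>_. 0) x"
proof -
  let ?z = "\<chi> j. x $ (i + j - 1)"
  have "v0_first \<alpha> v\<^sub>r \<xi> ?z = v\<^sub>r *
      ((\<Prod>j\<in>UNIV. sin (\<alpha> * ?z $ j + \<xi> $ j + real (quarters1 j) * (pi / 2)))
     - (\<Prod>j\<in>UNIV. sin (\<alpha> * ?z $ j + \<xi> $ (j + 1) + real (quarters2 j) * (pi / 2))))"
  proof -
    have "(7::6) = 1" by simp
    then have "\<xi> $ 7 = \<xi> $ 1" by (rule arg_cong)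
    then show ?thesis
      unfolding v0_first_def prod_6 quarters1_def quarters2_def
      by (simp add: sin_add del: vec_lambda_beta)
  qed
  also have "(\<Prod>j\<in>UNIV. sin (\<alpha> * ?z $ j + \<xi> $ j + real (quarters1 j) * (pi / 2)))
      = sinprod \<alpha> x (\<lambda>k. \<xi> $ (k - i + 1)) (\<lambda>k. quarters1 (k - i + 1))"
    unfolding sinprod_def
    by (rule prod.reindex_bij_witness[of _ "\<lambda>k. k - i + 1" "\<lambda>j. i + j - 1"])
       (auto simp: algebra_simps)
  also have "(\<Prod>j\<in>UNIV. sin (\<alpha> * ?z $ j + \<xi> $ (j + 1) + real (quarters2 j) * (pi / 2)))
      = sinprod \<alpha> x (\<lambda>k. \<xi> $ (k - i + 2)) (\<lambda>k. quarters2 (k - i + 1))"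
    unfolding sinprod_def
    by (rule prod.reindex_bij_witness[of _ "\<lambda>k. k - i + 1" "\<lambda>j. i + j - 1"])
       (auto simp: algebra_simps)
  finally show ?thesis by (simp add: v0_def velocity_jet_def)
qed

lemma add_bump: "(\<lambda>k. q k + bump j D k) = bump j (\<lambda>k. q k + D k)"
  by (auto simp: bump_def)

lemma velocity_jet_has_partial_deriv:
  "has_partial_deriv (velocity_jet \<alpha> \<xi> i D) j (\<alpha> * velocity_jet \<alpha> \<xi> i (bump j D) x) x"
  using DERIV_diff[OF
      sinprod_has_partial_deriv[of \<alpha> "\<lambda>k. \<xi> $ (k - i + 1)"
        "\<lambda>k. quarters1 (k - i + 1) + D k" j x, unfolded has_partial_deriv_def]
      sinprod_has_partial_deriv[of \<alpha> "\<lambda>k. \<xi> $ (k - i + 2)"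
        "\<lambda>k. quarters2 (k - i + 1) + D k" j x, unfolded has_partial_deriv_def]]
  unfolding has_partial_deriv_def velocity_jet_def add_bump by (simp add: algebra_simps)

lemma continuous_on_velocity_jet: "continuous_on A (velocity_jet \<alpha> \<xi> i D)"
  unfolding velocity_jet_def by (intro continuous_intros continuous_on_sinprod)

lemma velocity_jet_bump_bump: "velocity_jet \<alpha> \<xi> i (bump j (bump j D)) x = - velocity_jet \<alpha> \<xi> i D x"
  unfolding velocity_jet_def add_bump sinprod_bump_bump by simp

lemma v0_has_partial_deriv:
  "has_partial_deriv (\<lambda>y. v0 \<alpha> v\<^sub>r \<xi> y $ i) j (\<alpha> * v\<^sub>r * velocity_jet \<alpha> \<xi> i (bump j (\<lambda>_. 0)) x) x"
  using has_partial_deriv_cmult[OF velocity_jet_has_partial_deriv, of v\<^sub>r \<alpha> \<xi> i "\<lambda>_. 0" j x]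
  by (simp add: v0_nth[abs_def] mult_ac)

lemma g0_nth:
  "g0 \<alpha> v\<^sub>r \<xi> x $ i
     = \<alpha> * v\<^sub>r\<^sup>2 * (\<Sum>j\<in>UNIV.
         velocity_jet \<alpha> \<xi> j (\<lambda>_. 0) x * velocity_jet \<alpha> \<xi> i (bump j (\<lambda>_. 0)) x)"
  unfolding g0_def convective_field_def vec_lambda_beta partial_deriv_eqI[OF v0_has_partial_deriv]
  by (simp add: v0_nth sum_distrib_left power2_eq_square mult_ac)

text \<open>
  The derivative of the \<open>i\<close>-th component of the convective field in direction \<open>l\<close>, by the product
  rule, without the factor \<open>(\<alpha> * v\<^sub>r)\<^sup>2\<close>.
\<close>
definition convective_jacobian :: "real \<Rightarrow> real ^ 6 \<Rightarrow> 6 \<Rightarrow> 6 \<Rightarrow> real ^ 6 \<Rightarrow> real" where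
  "convective_jacobian \<alpha> \<xi> i l x =
     (\<Sum>j\<in>UNIV. velocity_jet \<alpha> \<xi> j (bump l (\<lambda>_. 0)) x * velocity_jet \<alpha> \<xi> i (bump j (\<lambda>_. 0)) x
             + velocity_jet \<alpha> \<xi> j (\<lambda>_. 0) x * velocity_jet \<alpha> \<xi> i (bump l (bump j (\<lambda>_. 0))) x)"

lemma g0_has_partial_deriv:
  "has_partial_deriv (\<lambda>y. g0 \<alpha> v\<^sub>r \<xi> y $ i) l ((\<alpha> * v\<^sub>r)\<^sup>2 * convective_jacobian \<alpha> \<xi> i l x) x"
proof -
  have along_axis: "((\<lambda>s. velocity_jet \<alpha> \<xi> m D (x + s *\<^sub>R axis l 1)) has_real_derivative
      \<alpha> * velocity_jet \<alpha> \<xi> m (bump l D) x) (at 0)" for m D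
    using velocity_jet_has_partial_deriv unfolding has_partial_deriv_def .
  show ?thesis
    unfolding g0_nth has_partial_deriv_def convective_jacobian_def
    by (rule derivative_eq_intros along_axis | simp)+
      (simp add: sum_distrib_left power2_eq_square algebra_simps)
qed

lemma continuous_on_convective_jacobian: "continuous_on A (convective_jacobian \<alpha> \<xi> i l)"
  unfolding convective_jacobian_def by (intro continuous_intros continuous_on_velocity_jet)

section \<open>Pressure requires a curl-free convective field\<close>

lemma curl_free_if_pressure:
  assumes p: "\<And>i x. has_partial_deriv p i (c * g0 \<alpha> v\<^sub>r \<xi> x $ i) x" and "c \<noteq> 0"
  shows "curl_free (g0 \<alpha> v\<^sub>r \<xi>)"
proof -
  have "c * ((\<alpha> * v\<^sub>r)\<^sup>2 * convective_jacobian \<alpha> \<xi> i j x)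
      = c * ((\<alpha> * v\<^sub>r)\<^sup>2 * convective_jacobian \<alpha> \<xi> j i x)" for i j x
    by (rule jacobian_of_gradient_symmetric[of p "\<lambda>i x. c * g0 \<alpha> v\<^sub>r \<xi> x $ i"
          "\<lambda>i j x. c * ((\<alpha> * v\<^sub>r)\<^sup>2 * convective_jacobian \<alpha> \<xi> i j x)"])
       (intro p has_partial_deriv_cmult g0_has_partial_deriv continuous_intros
         continuous_on_convective_jacobian)+
  with \<open>c \<noteq> 0\<close> show ?thesis
    by (auto simp: curl_free_def partial_deriv_eqI[OF g0_has_partial_deriv])
qed

lemma curl_free_iff:
  assumes "\<alpha> \<noteq> 0" "v\<^sub>r \<noteq> 0"
  shows "curl_free (g0 \<alpha> v\<^sub>r \<xi>) \<longleftrightarrow> (\<forall>i l x. convective_jacobian \<alpha> \<xi> i l x = convective_jacobian \<alpha> \<xi> l i x)"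
  using assms by (simp add: curl_free_def partial_deriv_eqI[OF g0_has_partial_deriv])

text \<open>
  Viscous decay is exactly balanced by the time dependence, and the convective term is quadratic in
  the velocity; hence the pressure gradient is the convective field with the squared time factor.
\<close>
lemma navier_stokes_pressure_gradient:
  assumes "\<rho> \<noteq> 0"
    and NS: "navier_stokes_solution \<rho> \<kappa> T
      (\<lambda>t x. exp (- 6 * \<alpha>\<^sup>2 * \<kappa> * t) *\<^sub>R v0 \<alpha> v\<^sub>r \<xi> x) p"
    and "t \<in> T"
  shows "has_partial_deriv (p t) i (- \<rho> * g0 \<alpha> v\<^sub>r \<xi> x $ i * exp (- 12 * \<alpha>\<^sup>2 * \<kappa> * t)) x"
proof -
  define E where "E t = exp (- 6 * \<alpha>\<^sup>2 * \<kappa> * t)" for t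
  let ?v = "\<lambda>t x. E t *\<^sub>R v0 \<alpha> v\<^sub>r \<xi> x"
  have comp: "(E t *\<^sub>R v0 \<alpha> v\<^sub>r \<xi> y) $ k = E t * (v\<^sub>r * velocity_jet \<alpha> \<xi> k (\<lambda>_. 0) y)" for t y k
    by (simp add: v0_nth)
  have time: "deriv (\<lambda>s. ?v s x $ i) t = - 6 * \<alpha>\<^sup>2 * \<kappa> * (E t * v0 \<alpha> v\<^sub>r \<xi> x $ i)"
    unfolding E_def by (rule DERIV_imp_deriv) (auto intro!: derivative_eq_intros)
  have first: "partial_deriv j (\<lambda>y. ?v t y $ i)
      = (\<lambda>y. E t * (v\<^sub>r * (\<alpha> * velocity_jet \<alpha> \<xi> i (bump j (\<lambda>_. 0)) y)))"
    for j
    unfolding comp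
    by (rule ext) (intro partial_deriv_eqI has_partial_deriv_cmult velocity_jet_has_partial_deriv)
  \<comment> \<open>Two quarter turns change the sign, so each of the six second derivatives gives \<open>- \<alpha>\<^sup>2\<close> and
    the Laplacian cancels the time derivative.\<close>
  have second: "partial_deriv j (partial_deriv j (\<lambda>y. ?v t y $ i)) x
      = - \<alpha>\<^sup>2 * (E t * v0 \<alpha> v\<^sub>r \<xi> x $ i)" for j
  proof -
    have "partial_deriv j (partial_deriv j (\<lambda>y. ?v t y $ i)) x
        = E t * (v\<^sub>r * (\<alpha> * (\<alpha> * velocity_jet \<alpha> \<xi> i (bump j (bump j (\<lambda>_. 0))) x)))"
      unfolding first by (intro partial_deriv_eqI has_partial_deriv_cmult velocity_jet_has_partial_deriv)
    then show ?thesis by (simp add: velocity_jet_bump_bump v0_nth power2_eq_square)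
  qed
  have convection: "(\<Sum>j\<in>UNIV. ?v t x $ j * partial_deriv j (\<lambda>y. ?v t y $ i) x)
      = (E t)\<^sup>2 * g0 \<alpha> v\<^sub>r \<xi> x $ i"
    unfolding first g0_nth by (simp add: v0_nth sum_distrib_left power2_eq_square mult_ac)
  have NSx: "partial_differentiable (p t) i x"
    "deriv (\<lambda>s. ?v s x $ i) t + (\<Sum>j\<in>UNIV. ?v t x $ j * partial_deriv j (\<lambda>y. ?v t y $ i) x)
       = \<kappa> * (\<Sum>j\<in>UNIV. partial_deriv j (partial_deriv j (\<lambda>y. ?v t y $ i)) x)
         - inverse \<rho> * partial_deriv i (p t) x"
    using NS \<open>t \<in> T\<close> unfolding navier_stokes_solution_def E_def by blast+
  have "(E t)\<^sup>2 * g0 \<alpha> v\<^sub>r \<xi> x $ i = - inverse \<rho> * partial_deriv i (p t) x"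
    using NSx(2) unfolding time convection second by simp
  then have "partial_deriv i (p t) x = - \<rho> * g0 \<alpha> v\<^sub>r \<xi> x $ i * (E t)\<^sup>2"
    using \<open>\<rho> \<noteq> 0\<close> by (simp add: field_simps)
  moreover have "(E t)\<^sup>2 = exp (- 12 * \<alpha>\<^sup>2 * \<kappa> * t)"
    by (simp add: E_def power2_eq_square flip: exp_add)
  ultimately show ?thesis
    using has_partial_deriv_partial_deriv[OF NSx(1)] by simp
qed

section \<open>Evaluation at points with known sines\<close>

text \<open>The sine of an angle advanced by \<open>n\<close> quarter turns, in terms of its sine \<open>S\<close> and cosine \<open>C\<close>.\<close>
fun quarter_turn :: "nat \<Rightarrow> real \<Rightarrow> real \<Rightarrow> real" where
  "quarter_turn 0 S C = S"
| "quarter_turn (Suc n) S C = quarter_turn n C (- S)"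

lemma sin_quarter_turn:
  assumes "sin \<theta> = c * S" "cos \<theta> = c * C"
  shows "sin (\<theta> + real n * (pi / 2)) = c * quarter_turn n S C"
  using assms
proof (induction n arbitrary: \<theta> S C)
  case (Suc n)
  have "sin (\<theta> + pi / 2 + real n * (pi / 2)) = c * quarter_turn n C (- S)"
    by (rule Suc.IH) (use Suc.prems in \<open>simp_all add: sin_add cos_add\<close>)
  moreover have "\<theta> + real (Suc n) * (pi / 2) = \<theta> + pi / 2 + real n * (pi / 2)"
    by (simp add: field_simps)
  ultimately show ?case by (simp only: quarter_turn.simps)
qed simp

text \<open>
  The velocity derivatives with the sines and cosines of the \<open>k\<close>-th coordinate replaced by numbers
  \<open>S k (s m)\<close> and \<open>C k (s m)\<close>, where \<open>s m\<close> is the sign of the \<open>m\<close>-th phase. The surds are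
  left out, so that integers remain.
\<close>
definition scaled_jet ::
    "(6 \<Rightarrow> real \<Rightarrow> real) \<Rightarrow> (6 \<Rightarrow> real \<Rightarrow> real) \<Rightarrow> (6 \<Rightarrow> real) \<Rightarrow> 6 \<Rightarrow> (6 \<Rightarrow> nat) \<Rightarrow> real"
where "scaled_jet S C s i D =
     (\<Prod>k\<in>UNIV. quarter_turn (quarters1 (k - i + 1) + D k) (S k (s (k - i + 1))) (C k (s (k - i + 1))))
   - (\<Prod>k\<in>UNIV. quarter_turn (quarters2 (k - i + 1) + D k) (S k (s (k - i + 2))) (C k (s (k - i + 2))))"

definition scaled_jacobian ::
    "(6 \<Rightarrow> real \<Rightarrow> real) \<Rightarrow> (6 \<Rightarrow> real \<Rightarrow> real) \<Rightarrow> (6 \<Rightarrow> real) \<Rightarrow> 6 \<Rightarrow> 6 \<Rightarrow> real"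
where "scaled_jacobian S C s i l =
     (\<Sum>j\<in>UNIV. scaled_jet S C s j (bump l (\<lambda>_. 0)) * scaled_jet S C s i (bump j (\<lambda>_. 0))
             + scaled_jet S C s j (\<lambda>_. 0) * scaled_jet S C s i (bump l (bump j (\<lambda>_. 0))))"

text \<open>
  Each coordinate contributes exactly one factor to every product of sines. Whatever scale \<open>c k\<close> the
  sines and cosines of the \<open>k\<close>-th coordinate have in common therefore comes out of every velocity
  derivative, and its square out of the Jacobian, which is quadratic in these derivatives.
\<close>
lemma convective_jacobian_eq_scaled:
  assumes sin: "\<And>k m. sin (\<alpha> * x $ k + \<xi> $ m) = c k * S k (s m)"
    and cos: "\<And>k m. cos (\<alpha> * x $ k + \<xi> $ m) = c k * C k (s m)"
  shows "convective_jacobian \<alpha> \<xi> i l x = (\<Prod>k\<in>UNIV. c k)\<^sup>2 * scaled_jacobian S C s i l"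
proof -
  have "velocity_jet \<alpha> \<xi> i D x = (\<Prod>k\<in>UNIV. c k) * scaled_jet S C s i D" for i D
    unfolding velocity_jet_def scaled_jet_def sinprod_def
    by (simp only: sin_quarter_turn[OF sin cos] prod.distrib right_diff_distrib)
  then show ?thesis
    unfolding convective_jacobian_def scaled_jacobian_def
    by (simp add: sum_distrib_left power2_eq_square algebra_simps)
qed

section \<open>The curl for phases of absolute value pi/4\<close>

text \<open>
  Sine and cosine of \<open>\<alpha> * x $ k + s * pi / 4\<close> for a sign \<open>s\<close>, divided by \<open>1 / sqrt 2\<close>, at the
  point \<open>x\<close> whose sixth coordinate is a quarter period \<open>pi / (2 * \<alpha>)\<close> and whose other
  coordinates are 0.
\<close>
definition lattice_sin :: "6 \<Rightarrow> real \<Rightarrow> real" where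
  "lattice_sin k s = (if k = 6 then 1 else s)"

definition lattice_cos :: "6 \<Rightarrow> real \<Rightarrow> real" where
  "lattice_cos k s = (if k = 6 then - s else 1)"

text \<open>
  The same at the point with \<open>\<alpha> * x $ k = - (pi / 4)\<close> for \<open>k = 2, 3, 4\<close> and 0 otherwise. At these
  three coordinates the angle is 0 or \<open>- (pi / 2)\<close>, and there is no surd to divide by.
\<close>
definition gap_sin :: "6 \<Rightarrow> real \<Rightarrow> real" where
  "gap_sin k s = (if k \<in> {2, 3, 4} then (s - 1) / 2 else s)"

definition gap_cos :: "6 \<Rightarrow> real \<Rightarrow> real" where
  "gap_cos k s = (if k \<in> {2, 3, 4} then (s + 1) / 2 else 1)"

text \<open>
  The signs for which the two sine products of the velocity coincide, and those of the phase vector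
  \<open>\<xi>0\<close> and its negative.
\<close>
definition degenerate_signs :: "(6 \<Rightarrow> real) \<Rightarrow> real \<Rightarrow> bool" where
  "degenerate_signs s \<epsilon> \<longleftrightarrow>
     s 1 = \<epsilon> \<and> s 2 = \<epsilon> \<and> s 3 = - \<epsilon> \<and> s 4 = \<epsilon> \<and> s 5 = - \<epsilon> \<and> s 6 = \<epsilon>"

definition exceptional_signs :: "(6 \<Rightarrow> real) \<Rightarrow> real \<Rightarrow> bool" where
  "exceptional_signs s \<epsilon> \<longleftrightarrow>
     s 1 = - \<epsilon> \<and> s 2 = \<epsilon> \<and> s 3 = \<epsilon> \<and> s 4 = \<epsilon> \<and> s 5 = \<epsilon> \<and> s 6 = \<epsilon>"

text \<open>
  Since \<open>s m * s m = 1\<close>, each of the two curl entries reduces to a polynomial in which every sign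
  occurs at most once per monomial, and the common zeros are found by running through the sign
  vectors.
\<close>
lemma signs_if_lattice_curl_vanishes:
  assumes signs: "\<And>m. s m = 1 \<or> s m = - 1"
    and curl12: "scaled_jacobian lattice_sin lattice_cos s 1 2
      = scaled_jacobian lattice_sin lattice_cos s 2 1"
    and curl16: "scaled_jacobian lattice_sin lattice_cos s 1 6
      = scaled_jacobian lattice_sin lattice_cos s 6 1"
  shows "\<exists>\<epsilon>\<in>{1, - 1}. degenerate_signs s \<epsilon> \<or> exceptional_signs s \<epsilon>"
proof -
  have square: "s m * s m = 1" for m
    using signs[of m] by auto
  have square_left: "s m * (s m * y) = y" for m y
    using square[of m] by (simp flip: mult.assoc)
  note expand = scaled_jacobian_def scaled_jet_def sum_6 prod_6 quarters1_def quarters2_def bump_def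
    lattice_sin_def lattice_cos_def index_mod_6
  have poly12:
    "scaled_jacobian lattice_sin lattice_cos s 1 2 - scaled_jacobian lattice_sin lattice_cos s 2 1
     = 1 - 2 * s 1 * s 2 - 2 * s 1 * s 3 - s 1 * s 4 + 4 * s 1 * s 6
       + 6 * s 2 * s 3 + 2 * s 2 * s 5 + s 2 * s 6 - s 3 * s 4 - s 3 * s 5
       - s 4 * s 6 + 2 * s 5 * s 6 - s 1 * s 2 * s 3 * s 4
       + 2 * s 1 * s 2 * s 3 * s 5 + 2 * s 1 * s 2 * s 5 * s 6
       + 2 * s 1 * s 3 * s 4 * s 5 - 2 * s 1 * s 3 * s 5 * s 6
       - s 1 * s 4 * s 5 * s 6 - s 2 * s 3 * s 4 * s 5 - 4 * s 2 * s 3 * s 4 * s 6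
       - s 2 * s 3 * s 5 * s 6 + s 2 * s 4 * s 5 * s 6
       + 3 * s 1 * s 2 * s 3 * s 4 * s 5 * s 6"
    by (simp add: expand) (simp add: square square_left algebra_simps)
  have poly16:
    "scaled_jacobian lattice_sin lattice_cos s 1 6 - scaled_jacobian lattice_sin lattice_cos s 6 1
     = 2 + 3 * s 1 * s 2 + s 1 * s 3 - 2 * s 1 * s 4 + 3 * s 1 * s 6 + s 2 * s 3
       + s 2 * s 5 - s 2 * s 6 + 2 * s 3 * s 4 + 4 * s 3 * s 6 + 4 * s 4 * s 5
       - s 4 * s 6 + s 5 * s 6 - s 1 * s 2 * s 3 * s 4 + 6 * s 1 * s 2 * s 3 * s 5
       - s 1 * s 2 * s 3 * s 6 + 2 * s 1 * s 2 * s 4 * s 6 - s 1 * s 2 * s 5 * s 6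
       - s 1 * s 3 * s 4 * s 5 + s 1 * s 3 * s 4 * s 6 + s 1 * s 3 * s 5 * s 6
       + s 1 * s 4 * s 5 * s 6 - s 2 * s 3 * s 4 * s 6"
    by (simp add: expand) (simp add: square square_left algebra_simps)
  note zeros = poly12[unfolded curl12 diff_self] poly16[unfolded curl16 diff_self]
  show ?thesis
    using signs[of 1] signs[of 2] signs[of 3] signs[of 4] signs[of 5] signs[of 6] zeros
    unfolding degenerate_signs_def exceptional_signs_def
    by (elim disjE) simp_all
qed

text \<open>
  For these signs both curl entries of the previous lemma do vanish, so a second point is needed.
  Here half of the sines and cosines of the coordinates 2, 3 and 4 are zero, which leaves few terms.
\<close>
lemma exceptional_curl:
  assumes "\<epsilon> \<in> {1, - 1}" "exceptional_signs s \<epsilon>"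
  shows "scaled_jacobian gap_sin gap_cos s 1 6 - scaled_jacobian gap_sin gap_cos s 6 1 = - 4"
  using assms
  by (auto simp add: exceptional_signs_def scaled_jacobian_def scaled_jet_def sum_6 prod_6
      quarters1_def quarters2_def bump_def gap_sin_def gap_cos_def index_mod_6)

lemma lattice_point:
  assumes "\<alpha> \<noteq> 0" and signs: "\<And>m. s m = 1 \<or> s m = - 1" and \<xi>: "\<And>m. \<xi> $ m = s m * (pi / 4)"
  shows "convective_jacobian \<alpha> \<xi> i l (\<chi> k. if k = 6 then pi / (2 * \<alpha>) else 0)
    = (\<Prod>k\<in>(UNIV :: 6 set). sqrt 2 / 2)\<^sup>2 * scaled_jacobian lattice_sin lattice_cos s i l"
proof (rule convective_jacobian_eq_scaled)
  fix k m :: 6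
  show "sin (\<alpha> * (\<chi> k. if k = 6 then pi / (2 * \<alpha>) else 0) $ k + \<xi> $ m)
      = sqrt 2 / 2 * lattice_sin k (s m)"
    using \<open>\<alpha> \<noteq> 0\<close> signs[of m] by (auto simp: \<xi> lattice_sin_def sin_add sin_45 cos_45)
  show "cos (\<alpha> * (\<chi> k. if k = 6 then pi / (2 * \<alpha>) else 0) $ k + \<xi> $ m)
      = sqrt 2 / 2 * lattice_cos k (s m)"
    using \<open>\<alpha> \<noteq> 0\<close> signs[of m] by (auto simp: \<xi> lattice_cos_def cos_add sin_45 cos_45)
qed

lemma gap_point:
  assumes "\<alpha> \<noteq> 0" and signs: "\<And>m. s m = 1 \<or> s m = - 1" and \<xi>: "\<And>m. \<xi> $ m = s m * (pi / 4)"
  shows "convective_jacobian \<alpha> \<xi> i l (\<chi> k. if k \<in> {2, 3, 4} then - (pi / (4 * \<alpha>)) else 0)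
    = (\<Prod>k\<in>(UNIV :: 6 set). if k \<in> {2, 3, 4} then 1 else sqrt 2 / 2)\<^sup>2
      * scaled_jacobian gap_sin gap_cos s i l"
proof (rule convective_jacobian_eq_scaled)
  fix k m :: 6
  let ?x = "\<chi> k::6. if k \<in> {2, 3, 4} then - (pi / (4 * \<alpha>)) else 0"
  have x: "\<alpha> * ?x $ k = (if k \<in> {2, 3, 4} then - (pi / 4) else 0)"
    using \<open>\<alpha> \<noteq> 0\<close> by simp
  have quarter: "- (pi / 4) + - 1 * (pi / 4) = - (pi / 2)" by simp
  show "sin (\<alpha> * ?x $ k + \<xi> $ m)
      = (if k \<in> {2, 3, 4} then 1 else sqrt 2 / 2) * gap_sin k (s m)"
    unfolding x \<xi> gap_sin_def
    using signs[of m] by (elim disjE) (simp_all only: quarter, auto simp: sin_45)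
  show "cos (\<alpha> * ?x $ k + \<xi> $ m)
      = (if k \<in> {2, 3, 4} then 1 else sqrt 2 / 2) * gap_cos k (s m)"
    unfolding x \<xi> gap_cos_def
    using signs[of m] by (elim disjE) (simp_all only: quarter, auto simp: cos_45)
qed

lemma not_curl_free_if_exceptional:
  assumes "\<alpha> \<noteq> 0" "v\<^sub>r \<noteq> 0" "\<epsilon> \<in> {1, - 1}" "exceptional_signs s \<epsilon>"
    and signs: "\<And>m. s m = 1 \<or> s m = - 1" and \<xi>: "\<And>m. \<xi> $ m = s m * (pi / 4)"
  shows "\<not> curl_free (g0 \<alpha> v\<^sub>r \<xi>)"
proof
  assume "curl_free (g0 \<alpha> v\<^sub>r \<xi>)"
  moreover have "(\<Prod>k\<in>(UNIV :: 6 set). if k \<in> {2, 3, 4} then 1 else sqrt 2 / 2) \<noteq> (0 :: real)"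
    by (subst prod_zero_iff) auto
  ultimately have "scaled_jacobian gap_sin gap_cos s 1 6 = scaled_jacobian gap_sin gap_cos s 6 1"
    using gap_point[OF assms(1) signs \<xi>, of 1 6] gap_point[OF assms(1) signs \<xi>, of 6 1]
    by (simp add: curl_free_iff[OF assms(1,2)] del: prod_zero_iff insert_iff)
  with exceptional_curl[OF assms(3,4)] show False by simp
qed

text \<open>
  Angles that differ by \<open>pi / 2\<close> have sines and cosines equal up to sign and exchange. Hence the
  two products consist of the same six factors, with the same sign.
\<close>
lemma v0_zero_if_degenerate:
  assumes "\<epsilon> \<in> {1, - 1}" "degenerate_signs s \<epsilon>" and \<xi>: "\<And>m. \<xi> $ m = s m * (pi / 4)"
  shows "v0 \<alpha> v\<^sub>r \<xi> x = 0"
proof -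
  have "sin (y - pi / 4) = - cos (y + pi / 4)" "cos (y - pi / 4) = sin (y + pi / 4)" for y
    by (simp_all add: sin_add sin_diff cos_add cos_diff sin_45 cos_45)
  then have "v0_first \<alpha> v\<^sub>r \<xi> z = 0" for z
    using assms(1,2) by (auto simp: v0_first_def \<xi> degenerate_signs_def)
  then show ?thesis by (simp add: v0_def vec_eq_iff)
qed

lemma v0_zero_if_curl_free:
  assumes "\<alpha> \<noteq> 0" "v\<^sub>r \<noteq> 0" and \<xi>: "\<And>k. \<xi> $ k \<in> {- (pi / 4), pi / 4}"
    and curl_free: "curl_free (g0 \<alpha> v\<^sub>r \<xi>)"
  shows "v0 \<alpha> v\<^sub>r \<xi> x = 0"
proof -
  define s where "s m = \<xi> $ m / (pi / 4)" for m
  have signs: "s m = 1 \<or> s m = - 1" for m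
    using \<xi>[of m] by (auto simp: s_def)
  have \<xi>_eq: "\<xi> $ m = s m * (pi / 4)" for m
    by (simp add: s_def)
  have "scaled_jacobian lattice_sin lattice_cos s i l = scaled_jacobian lattice_sin lattice_cos s l i"
    for i l
    using curl_free lattice_point[OF assms(1) signs \<xi>_eq, of i l]
      lattice_point[OF assms(1) signs \<xi>_eq, of l i]
    by (simp add: curl_free_iff[OF assms(1,2)])
  with signs_if_lattice_curl_vanishes[of s] signs
  obtain \<epsilon> where \<epsilon>: "\<epsilon> \<in> {1, - 1}" "degenerate_signs s \<epsilon> \<or> exceptional_signs s \<epsilon>"
    by blast
  moreover have "\<not> exceptional_signs s \<epsilon>"
    using not_curl_free_if_exceptional[OF assms(1,2) \<epsilon>(1) _ signs \<xi>_eq] curl_free by blast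
  ultimately show ?thesis
    using v0_zero_if_degenerate[OF \<epsilon>(1) _ \<xi>_eq] by blast
qed

lemma not_curl_free_xi0:
  assumes "\<alpha> \<noteq> 0" "v\<^sub>r \<noteq> 0"
  shows "\<not> curl_free (g0 \<alpha> v\<^sub>r \<xi>0)"
  by (rule not_curl_free_if_exceptional[OF assms, of 1 "\<lambda>m. if m = 1 then - 1 else 1"])
     (simp_all add: \<xi>0_def exceptional_signs_def)

section \<open>The theorem\<close>

theorem theorem6p4:
  fixes \<alpha> v\<^sub>r \<rho> \<kappa> :: real
  assumes "\<alpha> > 0" and "v\<^sub>r > 0" and "\<rho> > 0" and "\<kappa> > 0"
  shows "\<not> curl_free (g0 \<alpha> v\<^sub>r \<xi>0)
    \<and> (\<exists>i j. partial_deriv j (\<lambda>x. g0 \<alpha> v\<^sub>r \<xi>0 x $ i) \<noteq> partial_deriv i (\<lambda>x. g0 \<alpha> v\<^sub>r \<xi>0 x $ j))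
    \<and> (\<forall>T :: real set. open T \<and> T \<noteq> {} \<longrightarrow>
         (\<nexists>p :: real \<Rightarrow> real ^ 6 \<Rightarrow> real. \<forall>t\<in>T. \<forall>x i.
            has_partial_deriv (p t) i (- \<rho> * g0 \<alpha> v\<^sub>r \<xi>0 x $ i * exp (- 12 * \<alpha>\<^sup>2 * \<kappa> * t)) x))
    \<and> (\<forall>T :: real set. open T \<and> T \<noteq> {} \<longrightarrow>
         (\<nexists>p :: real \<Rightarrow> real ^ 6 \<Rightarrow> real.
            navier_stokes_solution \<rho> \<kappa> T
              (\<lambda>t x. exp (- 6 * \<alpha>\<^sup>2 * \<kappa> * t) *\<^sub>R v0 \<alpha> v\<^sub>r \<xi>0 x) p))
    \<and> (\<forall>\<xi> :: real ^ 6. (\<forall>k. \<xi> $ k \<in> {- (pi / 4), pi / 4}) \<longrightarrow>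
         curl_free (g0 \<alpha> v\<^sub>r \<xi>) \<longrightarrow> (\<forall>x. v0 \<alpha> v\<^sub>r \<xi> x = 0))"
proof (intro conjI allI impI notI)
  note not_curl_free = not_curl_free_xi0[of \<alpha> v\<^sub>r]
  show False if "curl_free (g0 \<alpha> v\<^sub>r \<xi>0)"
    using not_curl_free that assms by simp
  have "\<exists>i j x. partial_deriv j (\<lambda>x. g0 \<alpha> v\<^sub>r \<xi>0 x $ i) x
      \<noteq> partial_deriv i (\<lambda>x. g0 \<alpha> v\<^sub>r \<xi>0 x $ j) x"
    using not_curl_free assms by (simp add: curl_free_def)
  then show "\<exists>i j. partial_deriv j (\<lambda>x. g0 \<alpha> v\<^sub>r \<xi>0 x $ i) \<noteq> partial_deriv i (\<lambda>x. g0 \<alpha> v\<^sub>r \<xi>0 x $ j)"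
    by metis
  have no_pressure: False
    if "\<forall>x i. has_partial_deriv q i (- \<rho> * g0 \<alpha> v\<^sub>r \<xi>0 x $ i * exp (- 12 * \<alpha>\<^sup>2 * \<kappa> * t)) x" for q t
  proof -
    have "curl_free (g0 \<alpha> v\<^sub>r \<xi>0)"
      by (rule curl_free_if_pressure[of q "- \<rho> * exp (- 12 * \<alpha>\<^sup>2 * \<kappa> * t)"])
         (use that assms in \<open>simp_all add: mult_ac\<close>)
    with not_curl_free assms show False by simp
  qed
  show False
    if T: "open T \<and> T \<noteq> {}" and "\<exists>p. \<forall>t\<in>T. \<forall>x i.
      has_partial_deriv (p t) i (- \<rho> * g0 \<alpha> v\<^sub>r \<xi>0 x $ i * exp (- 12 * \<alpha>\<^sup>2 * \<kappa> * t)) x"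
    for T :: "real set"
    using that no_pressure by blast
  show False
    if T: "open T \<and> T \<noteq> {}" and "\<exists>p. navier_stokes_solution \<rho> \<kappa> T
      (\<lambda>t x. exp (- 6 * \<alpha>\<^sup>2 * \<kappa> * t) *\<^sub>R v0 \<alpha> v\<^sub>r \<xi>0 x) p"
    for T :: "real set"
  proof -
    obtain p t where "t \<in> T" "navier_stokes_solution \<rho> \<kappa> T
        (\<lambda>t x. exp (- 6 * \<alpha>\<^sup>2 * \<kappa> * t) *\<^sub>R v0 \<alpha> v\<^sub>r \<xi>0 x) p"
      using \<open>open T \<and> T \<noteq> {}\<close> \<open>\<exists>p. navier_stokes_solution _ _ _ _ p\<close> by blast
    then have "has_partial_deriv (p t) i
        (- \<rho> * g0 \<alpha> v\<^sub>r \<xi>0 x $ i * exp (- 12 * \<alpha>\<^sup>2 * \<kappa> * t)) x" for x i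
      using assms(3) by (intro navier_stokes_pressure_gradient) auto
    then show False
      using no_pressure by blast
  qed
  show "v0 \<alpha> v\<^sub>r \<xi> x = 0"
    if "\<forall>k. \<xi> $ k \<in> {- (pi / 4), pi / 4}" "curl_free (g0 \<alpha> v\<^sub>r \<xi>)" for \<xi> x
    using v0_zero_if_curl_free that assms by simp
qed

end
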